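(* Let $\mathcal H$ be a real or complex separable Hilbert space of infinite dimension, and let $B$ be a positive non-compact bounded operator on $\mathcal H$. If $\{c_i\}_{i=1}^{\infty}$ is a bounded sequence of positive numbers with $\sup_i c_i < \|B\|_{ess}$ and $\sum_{i=1}^\infty c_i = \infty$, then there is a sequence $\{P_i\}_{i=1}^{\infty}$ of rank-one projections on $\mathcal H$ such that $$B = \sum_{i=1}^{\infty} c_i P_i,$$ where the convergence is in the strong operator topology.
   Context: "Positive operator" means a bounded self-adjoint operator $B$ with $\langle Bx, x\rangle \geq 0$ for all $x \in \mathcal H$. "Projection" means self-adjoint (orthogonal) projection. The essential norm of a bounded operator $B$ on $\mathcal H$ is $\|B\|_{ess} = \inf\{\|B-K\| : K \text{ a compact operator on } \mathcal H\}$. *)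

theory Defs
  imports "HOL-Analysis.Analysis"
begin

(* The scalar field of the Hilbert space. Up to isomorphism the only members of this class are
   the reals with trivial conjugation and the complex numbers (see real_or_complex_cases). *)
class real_or_complex = real_normed_field +
  fixes conjugate :: "'a \<Rightarrow> 'a"
  assumes conjugate_add: "conjugate (x + y) = conjugate x + conjugate y"
    and conjugate_mult: "conjugate (x * y) = conjugate x * conjugate y"
    and conjugate_conjugate: "conjugate (conjugate x) = x"
    and mult_conjugate_scaleR: "x * conjugate x = (norm x)\<^sup>2 *\<^sub>R 1"

instantiation real :: real_or_complex
begin
definition conjugate_real :: "real \<Rightarrow> real" where "conjugate_real x = x"
instance
  by standard (auto simp: conjugate_real_def power2_eq_square)
end

instantiation complex :: real_or_complex
begin
definition conjugate_complex :: "complex \<Rightarrow> complex" where "conjugate_complex = cnj"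
instance
  by standard (simp_all add: conjugate_complex_def complex_norm_square scaleR_conv_of_real
      del: of_real_power)
end

lemma mult_conjugate: "(x::'k::real_or_complex) * conjugate x = of_real ((norm x)\<^sup>2)"
  unfolding of_real_def by (rule mult_conjugate_scaleR)

lemma conjugate_fixed_real:
  fixes x :: "'k::real_or_complex"
  assumes "conjugate x = x"
  shows "x = of_real (norm x) \<or> x = - of_real (norm x)"
  using mult_conjugate[of x] assms by (simp add: power2_eq_square square_eq_iff)

lemma real_or_complex_cases:
  "(\<forall>x::'k::real_or_complex. x \<in> \<real>) \<or>
   (\<exists>i::'k. i * i = -1 \<and> (\<forall>x. \<exists>a b. x = of_real a + of_real b * i))"
proof (cases "\<forall>x::'k. x \<in> \<real>")
  case False
  have fixed: "x \<in> \<real>" if "conjugate x = x" for x :: 'k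
    using conjugate_fixed_real[OF that] by (metis Reals_minus Reals_of_real)
  have re: "\<exists>a. x + conjugate x = of_real (2 * a)" for x :: 'k
  proof -
    have "x + conjugate x \<in> \<real>"
      by (rule fixed) (simp add: conjugate_add conjugate_conjugate add.commute)
    then obtain r where "x + conjugate x = of_real r" by (auto elim: Reals_cases)
    then show ?thesis by (intro exI[of _ "r / 2"]) simp
  qed
  have im: "\<exists>a s. (x - of_real a) * (x - of_real a) = of_real s" for x :: 'k
  proof -
    obtain a where a: "x + conjugate x = of_real (2 * a)" using re by blast
    then have c: "conjugate x = of_real (2 * a) - x" by (simp add: algebra_simps)
    have "x * (of_real (2 * a) - x) = of_real ((norm x)\<^sup>2)"
      using mult_conjugate[of x] c by simp
    then have "(x - of_real a) * (x - of_real a) = of_real (a * a - (norm x)\<^sup>2)"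
      by (simp add: algebra_simps)
    then show ?thesis by blast
  qed
  from False obtain z :: 'k where z: "z \<notin> \<real>" by blast
  obtain a s where as: "(z - of_real a) * (z - of_real a) = of_real s" using im by blast
  have za: "z - of_real a \<notin> \<real>"
    using z by (metis Reals_add Reals_of_real diff_add_cancel)
  have "s < 0"
  proof (rule ccontr)
    assume "\<not> s < 0"
    then have "(z - of_real a) * (z - of_real a) = of_real (sqrt s) * of_real (sqrt s)"
      using as by (simp flip: of_real_mult)
    then have "z - of_real a = of_real (sqrt s) \<or> z - of_real a = - of_real (sqrt s)"
      by (simp only: square_eq_iff)
    then show False using za by (metis Reals_minus Reals_of_real)
  qed
  define i where "i = (z - of_real a) / of_real (sqrt (- s))"
  have i2: "i * i = -1"
    using as \<open>s < 0\<close> by (simp add: i_def times_divide_times_eq flip: of_real_mult)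
  have "\<exists>a b. x = of_real a + of_real b * i" for x :: 'k
  proof -
    obtain b t where bt: "(x - of_real b) * (x - of_real b) = of_real t" using im by blast
    show ?thesis
    proof (cases "t < 0")
      case True
      have "(x - of_real b) * (x - of_real b) =
          (of_real (sqrt (- t)) * i) * (of_real (sqrt (- t)) * i)"
      proof -
        have "(of_real (sqrt (- t)) * i) * (of_real (sqrt (- t)) * i)
            = of_real (sqrt (- t) * sqrt (- t)) * (i * i)"
          unfolding of_real_mult by (simp only: mult_ac)
        then show ?thesis using True bt i2 by simp
      qed
      then have "x - of_real b = of_real (sqrt (- t)) * i \<or>
          x - of_real b = - (of_real (sqrt (- t)) * i)"
        by (simp only: square_eq_iff)
      then have "x = of_real b + of_real (sqrt (- t)) * i \<or>
          x = of_real b + of_real (- sqrt (- t)) * i"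
        by (auto simp: algebra_simps)
      then show ?thesis by blast
    next
      case False
      then have "(x - of_real b) * (x - of_real b) = of_real (sqrt t) * of_real (sqrt t)"
        using bt by (simp flip: of_real_mult)
      then have "x - of_real b = of_real (sqrt t) \<or> x - of_real b = - of_real (sqrt t)"
        by (simp only: square_eq_iff)
      then have "x = of_real (b + sqrt t) + of_real 0 * i \<or>
          x = of_real (b - sqrt t) + of_real 0 * i"
        by (auto simp: algebra_simps)
      then show ?thesis by blast
    qed
  qed
  with i2 show ?thesis by blast
qed simp

(* A Hilbert space over 'k, on a type whose norm is the one induced by the inner product.
   The inner product is linear in the first argument. *)
locale hilbert_space = vector_space scale
  for scale :: "'k::real_or_complex \<Rightarrow> 'a::banach \<Rightarrow> 'a" +
  fixes ip :: "'a \<Rightarrow> 'a \<Rightarrow> 'k"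
  assumes scale_of_real: "scale (of_real r) x = r *\<^sub>R x"
    and ip_add_left: "ip (x + y) z = ip x z + ip y z"
    and ip_scale_left: "ip (scale a x) z = a * ip x z"
    and ip_conjugate: "ip x y = conjugate (ip y x)"
    and ip_self: "ip x x = of_real ((norm x)\<^sup>2)"
begin

definition infinite_dimensional :: bool where
  "infinite_dimensional \<longleftrightarrow> (\<nexists>b. finite_dimensional_vector_space scale b)"

(* The type of bounded_linear functions only provides real-linearity. *)
definition operator :: "('a \<Rightarrow>\<^sub>L 'a) \<Rightarrow> bool" where
  "operator A \<longleftrightarrow> Vector_Spaces.linear scale scale (blinfun_apply A)"

definition self_adjoint :: "('a \<Rightarrow>\<^sub>L 'a) \<Rightarrow> bool" where
  "self_adjoint A \<longleftrightarrow> operator A \<and> (\<forall>x y. ip (A x) y = ip x (A y))"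

definition positive_operator :: "('a \<Rightarrow>\<^sub>L 'a) \<Rightarrow> bool" where
  "positive_operator A \<longleftrightarrow> self_adjoint A \<and> (\<forall>x. ip (A x) x \<in> \<real>\<^sub>\<ge>\<^sub>0)"

definition compact_operator :: "('a \<Rightarrow>\<^sub>L 'a) \<Rightarrow> bool" where
  "compact_operator A \<longleftrightarrow> operator A \<and> compact (closure (blinfun_apply A ` cball 0 1))"

definition ess_norm :: "('a \<Rightarrow>\<^sub>L 'a) \<Rightarrow> real" where
  "ess_norm A = Inf {norm (A - K) | K. compact_operator K}"

definition projection :: "('a \<Rightarrow>\<^sub>L 'a) \<Rightarrow> bool" where
  "projection P \<longleftrightarrow> self_adjoint P \<and> P o\<^sub>L P = P"

definition rank_one_projection :: "('a \<Rightarrow>\<^sub>L 'a) \<Rightarrow> bool" where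
  "rank_one_projection P \<longleftrightarrow> projection P \<and> dim (range (blinfun_apply P)) = 1"

end

lemma hilbert_space_real_inner:
  "hilbert_space (scaleR :: real \<Rightarrow> 'a \<Rightarrow> 'a::{real_inner, banach}) inner"
  by unfold_locales
    (auto simp: algebra_simps inner_add_left inner_commute conjugate_real_def power2_norm_eq_inner)

lemma hilbert_space_complex: "hilbert_space ((*) :: complex \<Rightarrow> complex \<Rightarrow> complex) (\<lambda>x y. x * cnj y)"
  by unfold_locales
    (auto simp: algebra_simps scaleR_conv_of_real conjugate_complex_def complex_norm_square
      simp del: of_real_power)

lemma limitin_strong_operator_topology_iff:
  fixes f :: "'i \<Rightarrow> 'a::real_normed_vector \<Rightarrow>\<^sub>L 'b::real_normed_vector"
  shows "limitin strong_operator_topology f l F \<longleftrightarrow> (\<forall>x. ((\<lambda>i. f i x) \<longlongrightarrow> l x) F)"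
proof
  assume L: "limitin strong_operator_topology f l F"
  show "\<forall>x. ((\<lambda>i. f i x) \<longlongrightarrow> l x) F"
    using continuous_map_limit[OF strong_operator_topology_continuous_evaluation L]
    by (auto simp: o_def)
next
  assume R: "\<forall>x. ((\<lambda>i. f i x) \<longlongrightarrow> l x) F"
  have lim: "((\<lambda>i. blinfun_apply (f i)) \<longlongrightarrow> blinfun_apply l) F"
    unfolding limitin_canonical_iff[symmetric] euclidean_product_topology[symmetric]
    using R by (subst limitin_componentwise) auto
  show "limitin strong_operator_topology f l F"
    unfolding limitin_def strong_operator_topology_topspace
  proof (intro conjI allI impI UNIV_I)
    fix U assume "openin strong_operator_topology U \<and> l \<in> U"
    then obtain V where V: "open V" "U = blinfun_apply -` V" "l \<in> U"
      unfolding strong_operator_topology_def openin_pullback_topology by auto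
    then have "eventually (\<lambda>i. blinfun_apply (f i) \<in> V) F"
      using lim by (auto intro: topological_tendstoD)
    then show "eventually (\<lambda>i. f i \<in> U) F" using V by simp
  qed
qed

end

theory Submission
  imports Defs
begin

text \<open>
  The projections are removed from \<open>B\<close> one after the other. Let \<open>D n\<close> be the residual
  \<open>B - (\<Sum>i<n. c i *\<^sub>R P i)\<close>. The construction keeps it positive and drives it to zero
  strongly.

  By the Cauchy-Schwarz inequality for the form of a positive operator \<open>D\<close>, subtracting \<open>c\<close> times
  the projection onto the line of \<open>D u\<close> leaves a positive operator whenever
  \<open>c * qform D u \<le> norm (D u)\<^sup>2\<close>, where \<open>qform D u\<close> is the value of \<open>ip (D u) u\<close>
  (\<open>remove_rank_one\<close>). This leaves much freedom. Fix \<open>t\<close> with \<open>sup c < t < ess_norm B\<close>. The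
  residuals differ from \<open>B\<close> by operators of finite rank, so their essential norms also exceed \<open>t\<close>,
  and every subspace of finite codimension contains vectors \<open>w\<close> with
  \<open>qform D w > t * norm w\<^sup>2\<close> (\<open>exists_orthogonal_large_qform\<close>). Adding such a vector to a given
  vector \<open>v\<close>, where needed, yields an admissible \<open>u\<close> whose image \<open>D u\<close> is so well correlated with
  \<open>v\<close> that the step multiplies \<open>qform D v\<close> by at most \<open>1 - \<kappa> * c\<close>, with a constant
  \<open>\<kappa> > 0\<close> that depends only on \<open>norm B\<close>, \<open>sup c\<close> and \<open>t\<close>
  (\<open>exists_direction\<close>). For every other vector the form does not increase.

  It remains to choose \<open>v\<close> at each step. Let \<open>e\<close> enumerate a dense set, and take for \<open>v\<close> the
  \<open>e k\<close> at which the form, with summable weights, is largest up to a factor of two. Since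
  \<open>\<Sum>i. c i\<close> diverges, a potential argument shows that the form tends to zero at every \<open>e j\<close>
  (\<open>greedy_decay\<close>). For a bounded sequence of positive operators this gives strong convergence
  to zero (\<open>tendsto_zero_of_qform_dense\<close>).
\<close>

section \<open>The scalars\<close>

lemma conjugate_0 [simp]: "conjugate (0::'k::real_or_complex) = 0"
  using conjugate_add[of "0::'k" 0] by simp

lemma conjugate_of_real [simp]: "conjugate (of_real r :: 'k::real_or_complex) = of_real r"
proof (cases "r = 0")
  case False
  have "(of_real r :: 'k) * conjugate (of_real r) = of_real r * of_real r"
    using mult_conjugate[of "of_real r :: 'k"] by (simp add: power2_eq_square)
  with False show ?thesis by simp
qed simp

lemma norm_conjugate [simp]: "norm (conjugate x) = norm (x::'k::real_or_complex)"
proof (cases "x = 0")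
  case False
  have "norm x * norm (conjugate x) = norm x * norm x"
    using arg_cong[OF mult_conjugate[of x], of norm] by (simp add: norm_mult power2_eq_square)
  with False show ?thesis by simp
qed simp

text \<open>Closed balls of scalars being compact is what makes rank-one operators compact. Up to
  isomorphism the scalars are the reals or the complex numbers, so a closed ball is contained in the
  continuous image of an interval or of a square.\<close>

lemma compact_cball_scalars: "compact (cball (0::'k::real_or_complex) r)"
proof -
  have "\<exists>f::real \<times> real \<Rightarrow> 'k. continuous_on UNIV f \<and>
      (\<forall>z. \<exists>a b. z = f (a, b) \<and> \<bar>a\<bar> \<le> norm z \<and> \<bar>b\<bar> \<le> norm z)"
    using real_or_complex_cases
  proof
    assume "\<forall>x::'k. x \<in> \<real>"
    then have "\<exists>a b. z = of_real (fst (a, b)) \<and> \<bar>a\<bar> \<le> norm z \<and> \<bar>b\<bar> \<le> norm z" for z :: 'k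
      by (metis Reals_cases abs_zero fst_conv norm_ge_zero norm_of_real order_refl)
    then show ?thesis
      by (intro exI[of _ "\<lambda>p. of_real (fst p)"]) (auto intro!: continuous_intros)
  next
    assume "\<exists>i::'k. i * i = -1 \<and> (\<forall>x. \<exists>a b. x = of_real a + of_real b * i)"
    then obtain i :: 'k where i: "i * i = -1" "\<And>x. \<exists>a b. x = of_real a + of_real b * i"
      by blast
    have "norm i * norm i = 1" using i(1) by (metis norm_minus_cancel norm_mult norm_one)
    then have "i * conjugate i = 1"
      using mult_conjugate[of i] by (simp add: power2_eq_square)
    then have ci: "conjugate i = - i"
      using i(1) by (metis minus_minus mult_1 mult_minus_left mult.assoc mult.commute)
    have "\<bar>a\<bar> \<le> norm z \<and> \<bar>b\<bar> \<le> norm z" if "z = of_real a + of_real b * i" for z a b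
    proof -
      have "of_real ((norm z)\<^sup>2) = z * conjugate z" by (simp add: mult_conjugate)
      also have "\<dots> = (of_real a + of_real b * i) * (of_real a - of_real b * i)"
        by (simp add: that conjugate_add conjugate_mult ci)
      also have "\<dots> = of_real a * of_real a - of_real b * of_real b * (i * i)"
        by (simp add: algebra_simps)
      also have "\<dots> = of_real (a\<^sup>2 + b\<^sup>2)" by (simp add: i(1) power2_eq_square)
      finally have "(norm z)\<^sup>2 = a\<^sup>2 + b\<^sup>2" by (simp only: of_real_eq_iff)
      then show ?thesis by (auto intro!: abs_le_square_iff[THEN iffD2, of _ "norm z", simplified])
    qed
    then have "\<exists>a b. z = of_real (fst (a, b)) + of_real (snd (a, b)) * i \<and>
        \<bar>a\<bar> \<le> norm z \<and> \<bar>b\<bar> \<le> norm z" for z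
      using i(2)[of z] unfolding fst_conv snd_conv by blast
    then show ?thesis
      by (intro exI[of _ "\<lambda>p. of_real (fst p) + of_real (snd p) * i"])
        (auto intro!: continuous_intros)
  qed
  then obtain f :: "real \<times> real \<Rightarrow> 'k" where f: "continuous_on UNIV f"
    "\<And>z. \<exists>a b. z = f (a, b) \<and> \<bar>a\<bar> \<le> norm z \<and> \<bar>b\<bar> \<le> norm z" by blast
  define K where "K = f ` ({-r..r} \<times> {-r..r})"
  have "compact K" unfolding K_def
    by (intro compact_continuous_image continuous_on_subset[OF f(1)] compact_Times) auto
  moreover have "cball 0 r \<subseteq> K"
  proof
    fix z :: 'k assume "z \<in> cball 0 r"
    then have "norm z \<le> r" by simp
    moreover obtain a b where "z = f (a, b)" "\<bar>a\<bar> \<le> norm z" "\<bar>b\<bar> \<le> norm z" using f(2) by blast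
    ultimately show "z \<in> K" unfolding K_def by (intro image_eqI[of _ _ "(a, b)"]) auto
  qed
  ultimately have "compact (K \<inter> cball 0 r)" by (intro compact_Int_closed) auto
  moreover have "K \<inter> cball 0 r = cball 0 r" using \<open>cball 0 r \<subseteq> K\<close> by blast
  ultimately show ?thesis by simp
qed

section \<open>Exhaustion by greedy choices\<close>

text \<open>Read \<open>a n k\<close> as the weighted energy left at stage \<open>n\<close> in the direction number
  \<open>k\<close>. The potential \<open>\<Sum>k. a n k\<close> is finite and drops at stage \<open>n\<close> by at least
  \<open>\<kappa> * c n\<close> times a nearly maximal entry, hence by at least \<open>\<kappa> / 2 * c n * a n j\<close> for every
  \<open>j\<close>. An entry that stayed above a positive level would therefore use up the potential, because
  the series of the \<open>c n\<close> diverges. In this way attacking one direction at a time exhausts all of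
  them, without a schedule fixed in advance.\<close>

lemma greedy_decay:
  fixes a :: "nat \<Rightarrow> nat \<Rightarrow> real" and c :: "nat \<Rightarrow> real"
  assumes nonneg: "\<And>n k. 0 \<le> a n k" and dominated: "\<And>n k. a n k \<le> g k" and "summable g"
    and decreasing: "\<And>n k. a (Suc n) k \<le> a n k"
    and greedy: "\<And>n. \<exists>k. (\<forall>j. a n j \<le> 2 * a n k) \<and> a (Suc n) k \<le> (1 - \<kappa> * c n) * a n k"
    and "\<And>n. 0 \<le> c n" "0 < \<kappa>"
    and diverges: "filterlim (\<lambda>n. \<Sum>i<n. c i) at_top sequentially"
  shows "(\<lambda>n. a n j) \<longlonglongrightarrow> 0"
proof -
  define \<Phi> where "\<Phi> n = (\<Sum>k. a n k)" for n
  have sm: "summable (a n)" for n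
    using nonneg dominated by (intro summable_comparison_test'[OF \<open>summable g\<close>]) auto
  have \<Phi>_nonneg: "0 \<le> \<Phi> n" for n
    unfolding \<Phi>_def by (intro suminf_nonneg sm nonneg)
  have drop: "\<kappa> / 2 * c n * a n j \<le> \<Phi> n - \<Phi> (Suc n)" for n
  proof -
    obtain k where k: "a n j \<le> 2 * a n k" "a (Suc n) k \<le> (1 - \<kappa> * c n) * a n k"
      using greedy by blast
    have "\<kappa> * c n * a n j \<le> \<kappa> * c n * (2 * a n k)"
      using assms k(1) by (intro mult_left_mono) (auto simp: less_imp_le)
    then have "\<kappa> / 2 * c n * a n j \<le> a n k - a (Suc n) k"
      using k(2) by (simp add: algebra_simps)
    also have "\<dots> = (\<Sum>i\<in>{k}. a n i - a (Suc n) i)" by simp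
    also have "\<dots> \<le> (\<Sum>i. a n i - a (Suc n) i)"
      using decreasing by (intro sum_le_suminf summable_diff sm) auto
    also have "\<dots> = \<Phi> n - \<Phi> (Suc n)" unfolding \<Phi>_def by (intro suminf_diff[symmetric] sm)
    finally show ?thesis .
  qed
  have dec: "decseq (\<lambda>n. a n j)" using decreasing by (intro decseq_SucI)
  then obtain L where L: "(\<lambda>n. a n j) \<longlonglongrightarrow> L" "\<And>n. L \<le> a n j"
    using nonneg by (metis decseq_convergent)
  have "L \<le> 0"
  proof (rule ccontr)
    assume "\<not> L \<le> 0"
    then have pos: "0 < \<kappa> / 2 * L" using \<open>0 < \<kappa>\<close> by simp
    have bound: "\<kappa> / 2 * L * (\<Sum>i<n. c i) \<le> \<Phi> 0 - \<Phi> n" for n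
    proof (induction n)
      case (Suc n)
      have "\<kappa> / 2 * c n * L \<le> \<kappa> / 2 * c n * a n j"
        using assms L(2) by (intro mult_left_mono) (auto simp: less_imp_le)
      moreover have "\<kappa> / 2 * L * (\<Sum>i<Suc n. c i)
          = \<kappa> / 2 * L * (\<Sum>i<n. c i) + \<kappa> / 2 * c n * L" by (simp add: algebra_simps)
      ultimately show ?case using drop[of n] Suc by linarith
    qed simp
    obtain n where "\<Phi> 0 / (\<kappa> / 2 * L) + 1 \<le> (\<Sum>i<n. c i)"
      using diverges unfolding filterlim_at_top eventually_sequentially by blast
    then have "\<Phi> 0 / (\<kappa> / 2 * L) < (\<Sum>i<n. c i)" by simp
    then have "\<Phi> 0 < (\<Sum>i<n. c i) * (\<kappa> / 2 * L)" by (subst (asm) pos_divide_less_eq[OF pos])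
    then show False using bound[of n] \<Phi>_nonneg[of n] by (simp add: mult.commute)
  qed
  moreover have "0 \<le> L" using L(1) nonneg by (intro LIMSEQ_le_const) auto
  ultimately show ?thesis using L(1) by simp
qed

lemma exists_nearly_maximal:
  fixes f :: "nat \<Rightarrow> real"
  assumes "\<And>k. 0 \<le> f k" "bdd_above (range f)"
  shows "\<exists>k. \<forall>j. f j \<le> 2 * f k"
proof (cases "\<forall>k. f k = 0")
  case False
  then obtain i where "0 < f i" using assms(1) by (metis less_eq_real_def)
  also have "f i \<le> (SUP k. f k)" by (intro cSUP_upper assms(2)) simp
  finally have "(SUP k. f k) / 2 < (SUP k. f k)" by simp
  then obtain k where k: "(SUP k. f k) / 2 < f k"
    by (subst (asm) less_cSUP_iff[OF _ assms(2)]) auto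
  have "f j \<le> 2 * f k" for j
    using cSUP_upper[OF _ assms(2), of j] k by simp
  then show ?thesis by blast
qed simp

section \<open>Inner products and positive operators\<close>

context hilbert_space
begin

lemma ip_add_right: "ip x (y + z) = ip x y + ip x z"
  using ip_conjugate[of x] ip_add_left by (metis conjugate_add)

lemma ip_scale_right: "ip x (scale a y) = conjugate a * ip x y"
  using ip_conjugate[of x] ip_scale_left by (metis conjugate_mult)

lemma ip_scaleR_left: "ip (r *\<^sub>R x) y = of_real r * ip x y"
  using ip_scale_left[of "of_real r"] by (simp add: scale_of_real)

lemma ip_scaleR_right: "ip x (r *\<^sub>R y) = of_real r * ip x y"
  using ip_scale_right[of x "of_real r"] by (simp add: scale_of_real)

lemma ip_zero_left [simp]: "ip 0 x = 0" and ip_zero_right [simp]: "ip x 0 = 0"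
  using ip_scaleR_left[of 0 0 x] ip_scaleR_right[of x 0 0] by simp_all

lemma ip_minus_left: "ip (- x) y = - ip x y" and ip_minus_right: "ip x (- y) = - ip x y"
  using ip_scaleR_left[of "- 1" x y] ip_scaleR_right[of x "- 1" y] by simp_all

lemma ip_diff_left: "ip (x - y) z = ip x z - ip y z"
  and ip_diff_right: "ip z (x - y) = ip z x - ip z y"
  using ip_add_left[of x "- y" z] ip_add_right[of z x "- y"]
  by (simp_all add: ip_minus_left ip_minus_right)

lemmas ip_simps = ip_add_left ip_add_right ip_diff_left ip_diff_right ip_scale_left ip_scale_right
  ip_scaleR_left ip_scaleR_right ip_minus_left ip_minus_right

lemma norm_scale: "norm (scale a x) = norm a * norm x"
proof -
  have "of_real ((norm (scale a x))\<^sup>2) = (a * conjugate a) * ip x x"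
    by (simp add: ip_self[symmetric] ip_scale_left ip_scale_right del: of_real_power)
  also have "\<dots> = of_real ((norm a * norm x)\<^sup>2)"
    by (simp add: mult_conjugate ip_self power_mult_distrib)
  finally have "(norm (scale a x))\<^sup>2 = (norm a * norm x)\<^sup>2" by (simp only: of_real_eq_iff)
  then show ?thesis by simp
qed

lemma scaleR_scale: "r *\<^sub>R scale a x = scale (r *\<^sub>R a) x"
  by (metis scale_of_real scale_scale scaleR_conv_of_real)

lemma operatorI: "(\<And>a x. blinfun_apply A (scale a x) = scale a (A x)) \<Longrightarrow> operator A"
  unfolding operator_def by (unfold_locales) (simp_all add: blinfun.add_right)

lemma operator_scale: "operator A \<Longrightarrow> A (scale a x) = scale a (A x)"
  unfolding operator_def by (simp add: Vector_Spaces.linear_iff)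

lemma self_adjoint_ip: "self_adjoint A \<Longrightarrow> ip (A x) y = ip x (A y)"
  by (simp add: self_adjoint_def)

text \<open>The norm only serves to make the value real; for positive \<open>A\<close> it is \<open>ip (A x) x\<close> itself
  (\<open>ip_eq_qform\<close>).\<close>

definition qform :: "('a \<Rightarrow>\<^sub>L 'a) \<Rightarrow> 'a \<Rightarrow> real" where
  "qform A x = norm (ip (A x) x)"

lemma qform_nonneg [simp]: "0 \<le> qform A x"
  by (simp add: qform_def)

lemma positive_operator_self_adjoint: "positive_operator A \<Longrightarrow> self_adjoint A"
  by (simp add: positive_operator_def)

lemma ip_eq_qform: "positive_operator A \<Longrightarrow> ip (A x) x = of_real (qform A x)"
  unfolding positive_operator_def qform_def by (metis abs_of_nonneg nonneg_Reals_cases norm_of_real)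

lemma positive_operatorI:
  assumes "self_adjoint A" "\<And>x. ip (A x) x = of_real (f x)" "\<And>x. 0 \<le> f x"
  shows "positive_operator A" "qform A x = f x"
  using assms by (auto simp: positive_operator_def qform_def)

lemma positive_operator_id: "positive_operator id_blinfun" "qform id_blinfun x = (norm x)\<^sup>2"
proof -
  have "self_adjoint id_blinfun" by (auto simp: self_adjoint_def intro: operatorI)
  then show "positive_operator id_blinfun" "qform id_blinfun x = (norm x)\<^sup>2"
    using positive_operatorI[of id_blinfun "\<lambda>x. (norm x)\<^sup>2"] by (auto simp: ip_self)
qed

text \<open>The Cauchy-Schwarz inequality for the semi-inner product \<open>(x, y) \<mapsto> ip (A x) y\<close>: with
  \<open>b = ip (A x) y\<close>, the form is nonnegative at \<open>x - t b y\<close> for every real \<open>t\<close>.\<close>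

lemma qform_Cauchy_Schwarz:
  assumes A: "positive_operator A"
  shows "(norm (ip (A x) y))\<^sup>2 \<le> qform A x * qform A y"
proof -
  define b where "b = ip (A x) y"
  have sa: "self_adjoint A" and op: "operator A"
    using A by (auto simp: positive_operator_def self_adjoint_def)
  have yx: "ip (A y) x = conjugate b"
    unfolding b_def using self_adjoint_ip[OF sa] ip_conjugate by metis
  have quad: "0 \<le> qform A x - 2 * t * (norm b)\<^sup>2 + t\<^sup>2 * (norm b)\<^sup>2 * qform A y" for t :: real
  proof -
    let ?a = "of_real t * b"
    let ?u = "x - scale ?a y"
    have "of_real (qform A ?u) = ip (A ?u) ?u" using ip_eq_qform[OF A] by simp
    also have "\<dots> = of_real (qform A x) - of_real t * (b * conjugate b)
        - of_real t * (b * conjugate b) + of_real (t\<^sup>2) * (b * conjugate b) * of_real (qform A y)"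
      by (simp add: blinfun.diff_right operator_scale[OF op] ip_simps yx ip_eq_qform[OF A]
          b_def[symmetric] conjugate_mult algebra_simps power2_eq_square)
    also have "\<dots> = of_real (qform A x - 2 * t * (norm b)\<^sup>2 + t\<^sup>2 * (norm b)\<^sup>2 * qform A y)"
      unfolding mult_conjugate by (simp add: algebra_simps)
    finally have "qform A ?u = qform A x - 2 * t * (norm b)\<^sup>2 + t\<^sup>2 * (norm b)\<^sup>2 * qform A y"
      by (simp only: of_real_eq_iff)
    then show ?thesis by (metis qform_nonneg)
  qed
  have "(norm b)\<^sup>2 \<le> qform A x * qform A y"
  proof (cases "qform A y = 0")
    case True
    have "b = 0"
    proof (rule ccontr)
      assume "b \<noteq> 0"
      then have "2 * ((qform A x + 1) / (norm b)\<^sup>2) * (norm b)\<^sup>2 = 2 * (qform A x + 1)"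
        by simp
      then show False using quad[of "(qform A x + 1) / (norm b)\<^sup>2"] True
        qform_nonneg[of A x] by simp
    qed
    then show ?thesis by simp
  next
    case False
    then have y: "qform A y > 0" using qform_nonneg[of A y] by linarith
    then show ?thesis using quad[of "1 / qform A y"]
      by (simp add: field_simps power2_eq_square)
  qed
  then show ?thesis by (simp add: b_def)
qed

lemma ip_Cauchy_Schwarz: "norm (ip x y) \<le> norm x * norm y"
proof -
  have "(norm (ip x y))\<^sup>2 \<le> (norm x * norm y)\<^sup>2"
    using qform_Cauchy_Schwarz[OF positive_operator_id(1), of x y]
    by (simp add: positive_operator_id(2) power_mult_distrib)
  then show ?thesis by (rule power2_le_imp_le) simp
qed

lemma qform_le_norm: "qform A x \<le> norm A * (norm x)\<^sup>2"
proof -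
  have "qform A x \<le> norm (A x) * norm x" unfolding qform_def by (rule ip_Cauchy_Schwarz)
  also have "\<dots> \<le> (norm A * norm x) * norm x" by (intro mult_right_mono norm_blinfun) auto
  finally show ?thesis by (simp add: power2_eq_square mult.assoc)
qed

text \<open>Cauchy-Schwarz for the pair \<open>x\<close>, \<open>A x\<close>. It turns control of the quadratic form into control
  of the operator: upper bounds of the form bound the norm, and where the form tends to zero, so
  does the operator.\<close>

lemma norm_sq_le_qform:
  assumes A: "positive_operator A" and M: "\<And>z. qform A z \<le> M * (norm z)\<^sup>2"
  shows "(norm (A x))\<^sup>2 \<le> M * qform A x"
proof (cases "A x = 0")
  case False
  have "(norm (A x))\<^sup>2 * (norm (A x))\<^sup>2 = (norm (ip (A x) (A x)))\<^sup>2"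
    by (simp add: ip_self power2_eq_square norm_mult)
  also have "\<dots> \<le> qform A x * qform A (A x)" by (rule qform_Cauchy_Schwarz[OF A])
  also have "\<dots> \<le> qform A x * (M * (norm (A x))\<^sup>2)" by (intro mult_left_mono M) auto
  finally have "(norm (A x))\<^sup>2 * (norm (A x))\<^sup>2 \<le> (M * qform A x) * (norm (A x))\<^sup>2"
    by (simp add: mult_ac)
  moreover have "0 < (norm (A x))\<^sup>2" using False by simp
  ultimately show ?thesis by (rule mult_right_le_imp_le)
next
  case True
  then have "qform A x = 0" by (simp add: qform_def)
  then show ?thesis using True by simp
qed

lemma norm_le_of_qform_le:
  assumes A: "positive_operator A" and M: "\<And>z. qform A z \<le> M * (norm z)\<^sup>2" and "0 \<le> M"
  shows "norm A \<le> M"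
proof (rule norm_blinfun_bound[OF \<open>0 \<le> M\<close>])
  fix x
  have "(norm (A x))\<^sup>2 \<le> M * qform A x" by (rule norm_sq_le_qform[OF A M])
  also have "\<dots> \<le> M * (M * (norm x)\<^sup>2)" by (intro mult_left_mono M \<open>0 \<le> M\<close>)
  finally have "(norm (A x))\<^sup>2 \<le> (M * norm x)\<^sup>2" by (simp add: power2_eq_square mult_ac)
  then show "norm (A x) \<le> M * norm x" by (rule power2_le_imp_le) (simp add: \<open>0 \<le> M\<close>)
qed

section \<open>Rank-one and compact operators\<close>

lift_definition outer :: "'a \<Rightarrow> 'a \<Rightarrow> 'a \<Rightarrow>\<^sub>L 'a" is "\<lambda>x y z. scale (ip z y) x"
proof (rule bounded_linear_intro[where K = "norm x * norm y" for x y])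
  fix x y z w :: 'a and r :: real
  show "scale (ip (z + w) y) x = scale (ip z y) x + scale (ip w y) x"
    by (simp add: ip_add_left scale_left_distrib)
  show "scale (ip (r *\<^sub>R z) y) x = r *\<^sub>R scale (ip z y) x"
    by (simp add: ip_scaleR_left scaleR_scale scaleR_conv_of_real)
  show "norm (scale (ip z y) x) \<le> norm z * (norm x * norm y)"
    using mult_right_mono[OF ip_Cauchy_Schwarz[of z y], of "norm x"]
    by (simp add: norm_scale mult_ac)
qed

lemma operator_outer: "operator (outer x y)"
  by (rule operatorI) (simp add: outer.rep_eq ip_scale_left)

lemma self_adjoint_outer: "self_adjoint (outer x x)"
  unfolding self_adjoint_def
proof (intro conjI operator_outer allI)
  show "ip (outer x x y) z = ip y (outer x x z)" for y z
    by (simp add: outer.rep_eq ip_scale_left ip_scale_right ip_conjugate[symmetric] mult.commute)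
qed

lemma compact_operator_outer: "compact_operator (outer x y)"
proof -
  define K where "K = (\<lambda>a. scale a x) ` cball 0 (norm y)"
  have "bounded_linear (\<lambda>a. scale a x)"
    by (rule bounded_linear_intro[where K = "norm x"])
      (simp_all add: scale_left_distrib scaleR_scale norm_scale)
  then have K: "compact K" unfolding K_def
    by (intro compact_continuous_image linear_continuous_on compact_cball_scalars)
  have "outer x y ` cball 0 1 \<subseteq> K"
  proof
    fix u assume "u \<in> outer x y ` cball 0 1"
    then obtain z where z: "norm z \<le> 1" "u = scale (ip z y) x" by (auto simp: outer.rep_eq)
    have "norm (ip z y) \<le> norm y"
      using ip_Cauchy_Schwarz[of z y] mult_right_mono[OF z(1), of "norm y"] by simp
    then show "u \<in> K" unfolding K_def z(2) by (intro imageI) simp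
  qed
  then have "closure (outer x y ` cball 0 1) \<subseteq> K"
    by (intro closure_minimal compact_imp_closed K)
  then have "compact (closure (outer x y ` cball 0 1))"
    using compact_Int_closed[OF K, of "closure (outer x y ` cball 0 1)"] by (simp add: inf.absorb2)
  then show ?thesis by (simp add: compact_operator_def operator_outer)
qed

lemma compact_operator_add:
  assumes "compact_operator K" "compact_operator L"
  shows "compact_operator (K + L)"
proof -
  let ?S = "{x + y | x y. x \<in> closure (K ` cball 0 1) \<and> y \<in> closure (L ` cball 0 1)}"
  have S: "compact ?S" using assms by (intro compact_sums) (auto simp: compact_operator_def)
  have "(K + L) ` cball 0 1 \<subseteq> ?S"
  proof
    fix u assume "u \<in> (K + L) ` cball 0 1"
    then obtain z where "z \<in> cball 0 1" "u = K z + L z" by (auto simp: blinfun.add_left)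
    then show "u \<in> ?S" using closure_subset by blast
  qed
  then have "closure ((K + L) ` cball 0 1) \<subseteq> ?S" by (intro closure_minimal compact_imp_closed S)
  then have "compact (closure ((K + L) ` cball 0 1))"
    using compact_Int_closed[OF S, of "closure ((K + L) ` cball 0 1)"] by (simp add: inf.absorb2)
  moreover have "operator (K + L)" using assms
    by (intro operatorI)
      (simp add: compact_operator_def operator_scale blinfun.add_left scale_right_distrib)
  ultimately show ?thesis by (simp add: compact_operator_def)
qed

lemma compact_operator_zero: "compact_operator 0"
proof -
  have "outer 0 0 = 0" by (rule blinfun_eqI) (simp add: outer.rep_eq)
  then show ?thesis using compact_operator_outer[of 0 0] by simp
qed

lemma ess_norm_le: "compact_operator K \<Longrightarrow> ess_norm A \<le> norm (A - K)"
  unfolding ess_norm_def by (rule cInf_lower) (auto intro!: bdd_belowI[of _ 0])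

text \<open>Applied to compact \<open>A - A'\<close>, this says that neither compressing to a hyperplane nor
  subtracting a rank-one operator lowers the essential norm.\<close>

lemma ess_norm_le_compact_perturbation:
  assumes "compact_operator (A - A')"
  shows "ess_norm A \<le> ess_norm A'"
  unfolding ess_norm_def[of A']
proof (rule cInf_greatest)
  show "{norm (A' - K) | K. compact_operator K} \<noteq> {}" using compact_operator_zero by blast
next
  fix r assume "r \<in> {norm (A' - K) | K. compact_operator K}"
  then obtain K where K: "compact_operator K" "r = norm (A' - K)" by blast
  have "ess_norm A \<le> norm (A - ((A - A') + K))"
    by (intro ess_norm_le compact_operator_add assms K)
  then show "ess_norm A \<le> r" by (simp add: K(2) algebra_simps)
qed

lemma rank_one_projection_outer:
  assumes "norm e = 1"
  shows "rank_one_projection (outer e e)"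
proof -
  have ee: "ip e e = 1" by (simp add: ip_self assms)
  have "outer e e o\<^sub>L outer e e = outer e e"
    by (rule blinfun_eqI) (simp add: outer.rep_eq ip_scale_left ee)
  moreover have "dim (range (outer e e)) = 1"
  proof -
    have "range (outer e e) = span {e}"
    proof
      show "range (outer e e) \<subseteq> span {e}"
        unfolding span_singleton outer.rep_eq by blast
      show "span {e} \<subseteq> range (outer e e)"
      proof
        fix u assume "u \<in> span {e}"
        then obtain a where "u = scale a e" by (auto simp: span_singleton)
        then have "u = outer e e (scale a e)" by (simp add: outer.rep_eq ip_scale_left ee)
        then show "u \<in> range (outer e e)" by blast
      qed
    qed
    moreover have "independent {e}" using assms by (auto simp: dependent_single)
    ultimately show ?thesis using dim_span_eq_card_independent by auto
  qed
  ultimately show ?thesis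
    by (simp add: rank_one_projection_def projection_def self_adjoint_outer)
qed

section \<open>Removing a rank-one operator from a positive operator\<close>

lemma self_adjoint_id: "self_adjoint id_blinfun"
  by (auto simp: self_adjoint_def intro: operatorI)

lemma self_adjoint_scaleR: "self_adjoint A \<Longrightarrow> self_adjoint (r *\<^sub>R A)"
  by (auto simp: self_adjoint_def blinfun.scaleR_left ip_simps operator_scale scaleR_scale
      scale_of_real[symmetric] mult.commute intro!: operatorI)

lemma self_adjoint_diff: "self_adjoint A \<Longrightarrow> self_adjoint A' \<Longrightarrow> self_adjoint (A - A')"
  by (auto simp: self_adjoint_def blinfun.diff_left ip_simps operator_scale
      scale_right_diff_distrib intro!: operatorI)

lemma ip_outer_self: "ip (outer x x z) z = of_real ((norm (ip z x))\<^sup>2)"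
  by (simp add: outer.rep_eq ip_scale_left ip_conjugate[of x z] mult_conjugate)

lemma qform_minus_outer:
  assumes D: "positive_operator D" and le: "\<And>z. c * (norm (ip z x))\<^sup>2 \<le> qform D z"
  shows "positive_operator (D - c *\<^sub>R outer x x)"
    and "qform (D - c *\<^sub>R outer x x) z = qform D z - c * (norm (ip z x))\<^sup>2"
proof -
  have sa: "self_adjoint (D - c *\<^sub>R outer x x)"
    by (intro self_adjoint_diff self_adjoint_scaleR self_adjoint_outer
        positive_operator_self_adjoint D)
  have "ip ((D - c *\<^sub>R outer x x) z) z = of_real (qform D z - c * (norm (ip z x))\<^sup>2)" for z
    using ip_eq_qform[OF D, of z] ip_outer_self[of x z]
    by (simp add: blinfun.diff_left blinfun.scaleR_left ip_simps)
  from positive_operatorI[OF sa this] le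
  show "positive_operator (D - c *\<^sub>R outer x x)"
    and "qform (D - c *\<^sub>R outer x x) z = qform D z - c * (norm (ip z x))\<^sup>2"
    by simp_all
qed

text \<open>The criterion for removing \<open>c\<close> times the projection onto the line of \<open>D u\<close> from \<open>D\<close>
  without losing positivity. By Cauchy-Schwarz
  \<open>(norm (ip z (D u)))\<^sup>2 \<le> qform D z * qform D u\<close>, so the hypothesis on \<open>u\<close> leaves room for
  the factor \<open>c\<close>.\<close>

lemma remove_rank_one:
  assumes D: "positive_operator D" and u: "D u \<noteq> 0" "c * qform D u \<le> (norm (D u))\<^sup>2"
    and c: "0 \<le> c"
  shows "c * (norm (ip z ((1 / norm (D u)) *\<^sub>R D u)))\<^sup>2 \<le> qform D z"
proof -
  have "c * (norm (ip (D z) u))\<^sup>2 \<le> c * (qform D z * qform D u)"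
    by (intro mult_left_mono qform_Cauchy_Schwarz D c)
  also have "\<dots> = qform D z * (c * qform D u)" by simp
  also have "\<dots> \<le> qform D z * (norm (D u))\<^sup>2" by (intro mult_left_mono u) simp
  finally have "c * (norm (ip z (D u)))\<^sup>2 \<le> qform D z * (norm (D u))\<^sup>2"
    by (simp add: self_adjoint_ip[OF positive_operator_self_adjoint[OF D]])
  then show ?thesis
    using u(1) by (simp add: ip_scaleR_right norm_divide power_divide field_simps norm_mult)
qed

section \<open>Vectors of large energy in subspaces of finite codimension\<close>

text \<open>Compression to the orthogonal complement of \<open>e\<close> is a compact perturbation, since
  \<open>A - P A P = (1 - P) A + P A (1 - P)\<close> is a sum of two operators of rank at most one.\<close>

lemma compression:
  assumes A: "positive_operator A" and e: "norm e = 1"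
  defines "P \<equiv> id_blinfun - outer e e"
  shows "positive_operator (P o\<^sub>L A o\<^sub>L P)" "qform (P o\<^sub>L A o\<^sub>L P) x = qform A (P x)"
    "compact_operator (A - (P o\<^sub>L A o\<^sub>L P))"
proof -
  have saA: "self_adjoint A" and opA: "operator A"
    using A by (auto simp: positive_operator_def self_adjoint_def)
  have saP: "self_adjoint P"
    unfolding P_def by (intro self_adjoint_diff self_adjoint_id self_adjoint_outer)
  then have opP: "operator P" by (simp add: self_adjoint_def)
  have sa: "self_adjoint (P o\<^sub>L A o\<^sub>L P)"
    unfolding self_adjoint_def
    by (auto simp: operator_scale[OF opA] operator_scale[OF opP] self_adjoint_ip[OF saA]
        self_adjoint_ip[OF saP] intro!: operatorI)
  have "ip ((P o\<^sub>L A o\<^sub>L P) x) x = of_real (qform A (P x))" for x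
    by (simp add: self_adjoint_ip[OF saP] ip_eq_qform[OF A])
  from positive_operatorI[OF sa this]
  show "positive_operator (P o\<^sub>L A o\<^sub>L P)" "qform (P o\<^sub>L A o\<^sub>L P) x = qform A (P x)" by simp_all
  have "A - (P o\<^sub>L A o\<^sub>L P) = outer (A e - scale (ip (A e) e) e) e + outer e (A e)"
    by (rule blinfun_eqI)
      (simp add: P_def blinfun.diff_left blinfun.diff_right blinfun.add_left outer.rep_eq
        operator_scale[OF opA] ip_simps scale_right_diff_distrib scale_left_diff_distrib
        self_adjoint_ip[OF saA] algebra_simps)
  then show "compact_operator (A - (P o\<^sub>L A o\<^sub>L P))"
    by (simp add: compact_operator_add compact_operator_outer)
qed

text \<open>This is where the essential norm enters. Without orthogonality conditions, the form must
  exceed \<open>t\<close> somewhere, since otherwise \<open>ess_norm A \<le> norm A \<le> t\<close>. A condition of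
  orthogonality to \<open>p\<close> is absorbed by compressing \<open>A\<close> to the complement of \<open>p\<close> and projecting
  the remaining vectors there. Since this does not lower the essential norm, induction on the
  number of conditions applies, with \<open>A\<close> varying.\<close>

lemma exists_orthogonal_large_qform:
  assumes "positive_operator A" "0 \<le> t" "t < ess_norm A"
  shows "\<exists>w. (\<forall>f\<in>set fs. ip w f = 0) \<and> t * (norm w)\<^sup>2 < qform A w"
  using assms
proof (induction "length fs" arbitrary: fs A)
  case 0
  show ?case
  proof (rule ccontr)
    assume "\<not> ?case"
    then have "norm A \<le> t" using 0 by (intro norm_le_of_qform_le) (auto simp: not_less)
    then show False using ess_norm_le[OF compact_operator_zero, of A] 0 by simp
  qed
next
  case (Suc n)
  then obtain p gs where fs: "fs = p # gs" "length gs = n" by (metis length_Suc_conv)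
  show ?case
  proof (cases "p = 0")
    case True
    then show ?thesis using Suc.hyps(1)[of gs A] Suc.prems fs by auto
  next
    case False
    define e where "e = (1 / norm p) *\<^sub>R p"
    define P where "P = id_blinfun - outer e e"
    have e: "norm e = 1" using False by (simp add: e_def)
    then have ee: "ip e e = 1" by (simp add: ip_self)
    have saP: "self_adjoint P"
      unfolding P_def by (intro self_adjoint_diff self_adjoint_id self_adjoint_outer)
    have PP: "P (P x) = P x" and Pe: "ip (P x) e = 0" for x
      by (simp_all add: P_def blinfun.diff_left outer.rep_eq ip_simps ee)
    note C = compression[OF Suc.prems(1) e, folded P_def]
    have "t < ess_norm (P o\<^sub>L A o\<^sub>L P)"
      using ess_norm_le_compact_perturbation[OF C(3)] Suc.prems by simp
    then obtain w where w: "\<forall>f\<in>set (map P gs). ip w f = 0" "t * (norm w)\<^sup>2 < qform A (P w)"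
      using Suc.hyps(1)[of "map P gs" "P o\<^sub>L A o\<^sub>L P"] Suc.prems fs C(1,2) by auto
    have "(norm (P w))\<^sup>2 = norm (ip (P (P w)) w)"
      unfolding self_adjoint_ip[OF saP, of "P w"] by (simp add: ip_self norm_power)
    also have "\<dots> \<le> norm (P w) * norm w" unfolding PP by (rule ip_Cauchy_Schwarz)
    finally have "norm (P w) \<le> norm w" by (cases "P w = 0") (auto simp: power2_eq_square)
    then have "t * (norm (P w))\<^sup>2 \<le> t * (norm w)\<^sup>2"
      by (intro mult_left_mono power_mono \<open>0 \<le> t\<close>) auto
    moreover have "ip (P w) p = 0"
    proof -
      have "p = norm p *\<^sub>R e" using False by (simp add: e_def)
      then show ?thesis using Pe[of w] by (metis ip_scaleR_right mult_zero_right)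
    qed
    ultimately show ?thesis using w fs
      by (intro exI[of _ "P w"]) (auto simp: self_adjoint_ip[OF saP])
  qed
qed

text \<open>The single step of the construction, in terms of the vector \<open>u\<close> whose image spans the line to
  be removed. The first inequality is the one that preserves positivity (\<open>remove_rank_one\<close>); the
  second says that the line is correlated with the prescribed \<open>v\<close>, so that removing \<open>c\<close>
  times the projection lowers \<open>qform D v\<close> by at least the proportion \<open>\<kappa> * c\<close>. Let \<open>w\<close> be a
  vector on which \<open>norm (D w)\<^sup>2 / qform D w\<close> is at least \<open>t > c\<close>. If \<open>qform D v = 0\<close>, the
  second inequality is void and \<open>u = w\<close> works. If \<open>qform D v > 0\<close> and \<open>v\<close> itself satisfies the first
  inequality, \<open>u = v\<close> works, because \<open>\<kappa> * M \<le> 1\<close>. Otherwise a multiple of \<open>w\<close> is added to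
  \<open>v\<close> so that the first inequality becomes an equality. Choosing \<open>w\<close> orthogonal to \<open>D v\<close> and
  \<open>D (D v)\<close> removes all cross terms, and the gap between \<open>s\<close> and \<open>t\<close> keeps the multiple small
  enough for the second inequality.\<close>

lemma exists_direction:
  assumes D: "positive_operator D" and M: "\<And>z. qform D z \<le> M * (norm z)\<^sup>2"
    and c: "0 < c" "c \<le> s" "s < t" "t < ess_norm D"
    and \<kappa>: "0 < \<kappa>" "\<kappa> * M \<le> 1" "\<kappa> \<le> 1 / s - 1 / t"
  shows "\<exists>u. D u \<noteq> 0 \<and> c * qform D u \<le> (norm (D u))\<^sup>2 \<and>
    \<kappa> * qform D v * (norm (D u))\<^sup>2 \<le> (norm (ip (D u) v))\<^sup>2"
proof -
  have sa: "self_adjoint D" by (rule positive_operator_self_adjoint[OF D])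
  have t: "0 < t" using c by simp
  obtain w where w: "ip w (D v) = 0" "ip w (D (D v)) = 0" "t * (norm w)\<^sup>2 < qform D w"
    using exists_orthogonal_large_qform[OF D, of t "[D v, D (D v)]"] c by auto
  have qw: "0 < qform D w"
  proof -
    have "0 \<le> t * (norm w)\<^sup>2" using t by simp
    then show ?thesis using w(3) by linarith
  qed
  have w0: "w \<noteq> 0" using qw by (auto simp: qform_def)
  have Dw: "t * qform D w \<le> (norm (D w))\<^sup>2"
  proof -
    have "(t * qform D w) * (norm w)\<^sup>2 \<le> qform D w * qform D w"
      using mult_right_mono[OF less_imp_le[OF w(3)], of "qform D w"] by (simp add: mult_ac)
    also have "\<dots> \<le> (norm (D w) * norm w) * (norm (D w) * norm w)"
      unfolding qform_def by (intro mult_mono ip_Cauchy_Schwarz) auto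
    also have "\<dots> = (norm (D w))\<^sup>2 * (norm w)\<^sup>2" by (simp add: power2_eq_square mult_ac)
    finally show ?thesis by (rule mult_right_le_imp_le) (simp add: w0)
  qed
  have Dw0: "D w \<noteq> 0" using qw by (auto simp: qform_def)
  consider (null) "qform D v = 0" | (self) "0 < qform D v" "c * qform D v \<le> (norm (D v))\<^sup>2"
    | (mix) "0 < qform D v" "(norm (D v))\<^sup>2 < c * qform D v"
    using qform_nonneg[of D v] by linarith
  then show ?thesis
  proof cases
    case null
    have "c * qform D w \<le> t * qform D w" using c qw by (intro mult_right_mono) auto
    then show ?thesis using null Dw Dw0 by (intro exI[of _ w]) auto
  next
    case self
    have "\<kappa> * qform D v * (norm (D v))\<^sup>2 \<le> \<kappa> * qform D v * (M * qform D v)"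
      using \<kappa> self by (intro mult_left_mono norm_sq_le_qform D M) auto
    also have "\<dots> = (\<kappa> * M) * (qform D v)\<^sup>2" by (simp add: power2_eq_square)
    also have "\<dots> \<le> 1 * (qform D v)\<^sup>2" using \<kappa> by (intro mult_right_mono) auto
    finally have "\<kappa> * qform D v * (norm (D v))\<^sup>2 \<le> (norm (ip (D v) v))\<^sup>2"
      by (simp add: qform_def)
    moreover have "D v \<noteq> 0" using self by (auto simp: qform_def)
    ultimately show ?thesis using self by blast
  next
    case mix
    define a b p m where "a = qform D v" and "b = (norm (D v))\<^sup>2"
      and "p = qform D w" and "m = (norm (D w))\<^sup>2"
    have "c * p < t * p" using c qw by (simp add: p_def)
    then have mp: "c * p < m" "(t - c) * p \<le> m - c * p"
      using Dw by (auto simp: m_def p_def algebra_simps)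
    \<comment> \<open>The coefficient that turns the positivity criterion for \<open>v + sqrt r *\<^sub>R w\<close> into an equality.\<close>
    define r where "r = (c * a - b) / (m - c * p)"
    have r: "0 < r" using mix mp by (simp add: r_def a_def b_def)
    define u where "u = v + sqrt r *\<^sub>R w"
    have Du: "D u = D v + sqrt r *\<^sub>R D w" by (simp add: u_def blinfun.add_right blinfun.scaleR_right)
    have orth: "ip (D w) (D v) = 0" "ip (D v) (D w) = 0" "ip (D w) v = 0" "ip (D v) w = 0"
      using w(1,2) self_adjoint_ip[OF sa] by (metis ip_conjugate conjugate_0)+
    have rr: "of_real (sqrt r) * (of_real (sqrt r) * z) = of_real r * z" for z :: 'k
      using r by (simp flip: mult.assoc of_real_mult)
    have "of_real ((norm (D u))\<^sup>2) = ip (D u) (D u)" by (simp only: ip_self)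
    also have "\<dots> = ip (D v) (D v) + of_real r * ip (D w) (D w)"
      by (simp add: Du ip_simps orth rr)
    also have "\<dots> = of_real (b + r * m)" by (simp add: ip_self b_def m_def)
    finally have nDu: "(norm (D u))\<^sup>2 = b + r * m" by (simp only: of_real_eq_iff)
    have "of_real (qform D u) = ip (D u) u" by (simp only: ip_eq_qform[OF D])
    also have "\<dots> = of_real (a + r * p)"
      unfolding Du by (simp add: u_def ip_simps orth ip_eq_qform[OF D] a_def p_def rr)
    finally have qu: "qform D u = a + r * p" by (simp only: of_real_eq_iff)
    have Duv: "ip (D u) v = of_real a"
      by (simp add: Du ip_simps orth ip_eq_qform[OF D] a_def)
    have "r * (m - c * p) = c * a - b" using mp by (simp add: r_def)
    then have balance: "b + r * m = c * (a + r * p)" by (simp add: algebra_simps)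
    have "r * ((t - c) * p) \<le> r * (m - c * p)" using r mp by (intro mult_left_mono) auto
    also have "\<dots> \<le> c * a" using \<open>r * (m - c * p) = c * a - b\<close> by (simp add: b_def)
    finally have "(t - c) * (a + r * p) \<le> t * a" by (simp add: algebra_simps)
    then have "(t - c) * (a + r * p) / t \<le> a" using t by (simp add: pos_divide_le_eq mult.commute)
    moreover have "(1 / c - 1 / t) * (c * (a + r * p)) = (t - c) * (a + r * p) / t"
      using c t by (simp add: divide_simps)
    ultimately have "(1 / c - 1 / t) * (c * (a + r * p)) \<le> a" by simp
    moreover have "\<kappa> \<le> 1 / c - 1 / t" using \<kappa>(3) c frac_le[of 1 1 c s] by simp
    moreover have apos: "0 < a" "0 < p" using mix qw by (auto simp: a_def p_def)
    then have pos: "0 < c * (a + r * p)" using c r by (simp add: add_pos_pos)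
    ultimately have "\<kappa> * (c * (a + r * p)) \<le> a"
      by (meson mult_right_mono less_imp_le order_trans)
    then have "\<kappa> * (c * (a + r * p)) * a \<le> a * a" using apos by (intro mult_right_mono) auto
    then have "\<kappa> * a * (norm (D u))\<^sup>2 \<le> (norm (ip (D u) v))\<^sup>2"
      unfolding nDu balance Duv by (simp add: power2_eq_square mult_ac)
    moreover have "c * qform D u \<le> (norm (D u))\<^sup>2" unfolding nDu qu balance by simp
    moreover have "D u \<noteq> 0" using pos nDu balance by auto
    ultimately show ?thesis by (auto simp: a_def)
  qed
qed

section \<open>The decomposition\<close>

text \<open>A uniform bound on the forms bounds the operators uniformly, so that strong convergence needs to
  be checked on a dense set only, and there \<open>norm_sq_le_qform\<close> reduces it to the forms.\<close>

lemma tendsto_zero_of_qform_dense: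
  assumes pos: "\<And>n. positive_operator (D n)" and M: "\<And>n z. qform (D n) z \<le> M * (norm z)\<^sup>2"
    and "0 < M"
    and dense: "closure (range e) = UNIV" and lim: "\<And>j. (\<lambda>n. qform (D n) (e j)) \<longlonglongrightarrow> 0"
  shows "(\<lambda>n. D n x) \<longlonglongrightarrow> 0"
proof (rule tendstoI)
  fix \<epsilon> :: real assume \<epsilon>: "0 < \<epsilon>"
  have "x \<in> closure (range e)" by (simp add: dense)
  moreover have "0 < \<epsilon> / (2 * M)" using \<epsilon> \<open>0 < M\<close> by simp
  ultimately obtain j where j: "dist (e j) x < \<epsilon> / (2 * M)"
    unfolding closure_approachable by blast
  have "eventually (\<lambda>n. qform (D n) (e j) < (\<epsilon> / 2)\<^sup>2 / M) sequentially"
    using \<epsilon> \<open>0 < M\<close> by (intro order_tendstoD(2)[OF lim]) simp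
  then show "eventually (\<lambda>n. dist (D n x) 0 < \<epsilon>) sequentially"
  proof eventually_elim
    case (elim n)
    have "(norm (D n (e j)))\<^sup>2 \<le> M * qform (D n) (e j)" by (intro norm_sq_le_qform pos M)
    also have "\<dots> < (\<epsilon> / 2)\<^sup>2" using elim \<open>0 < M\<close> by (simp add: field_simps)
    finally have near: "norm (D n (e j)) < \<epsilon> / 2"
      by (rule power_less_imp_less_base) (use \<epsilon> in simp)
    have "norm (D n (x - e j)) \<le> norm (D n) * norm (x - e j)" by (rule norm_blinfun)
    also have "\<dots> \<le> M * norm (x - e j)"
      using norm_le_of_qform_le[OF pos M] \<open>0 < M\<close> by (intro mult_right_mono) auto
    also have "\<dots> \<le> \<epsilon> / 2"
      using j \<open>0 < M\<close> by (simp add: dist_norm norm_minus_commute field_simps)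
    finally show ?case
      using near norm_triangle_ineq[of "D n (x - e j)" "D n (e j)"]
      by (simp add: blinfun.diff_right)
  qed
qed

theorem exists_rank_one_decomposition:
  assumes separable: "separable_space (euclidean :: 'a topology)"
    and B: "positive_operator B"
    and c: "\<And>i. c i > 0" "bdd_above (range c)" "(SUP i. c i) < ess_norm B"
    and diverges: "filterlim (\<lambda>n. \<Sum>i<n. c i) at_top sequentially"
  shows "\<exists>P. (\<forall>i. rank_one_projection (P i)) \<and>
    limitin strong_operator_topology (\<lambda>n. \<Sum>i<n. c i *\<^sub>R P i) B sequentially"
proof -
  obtain S :: "'a set" where S: "countable S" "closure S = UNIV"
    using separable by (auto simp: separable_space_def)
  then have "S \<noteq> {}" by auto
  define e where "e = from_nat_into S"
  have dense: "closure (range e) = UNIV"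
    using S \<open>S \<noteq> {}\<close> by (simp add: e_def range_from_nat_into)
  define s where "s = (SUP i. c i)"
  define t where "t = (s + ess_norm B) / 2"
  have cs: "c i \<le> s" for i unfolding s_def by (intro cSUP_upper c) simp
  have st: "s < t" "t < ess_norm B" using c(3) by (auto simp: t_def s_def)
  have "0 < s" using c(1)[of 0] cs[of 0] by simp
  define M where "M = norm B + 1"
  have "0 < M" by (simp add: M_def add_nonneg_pos)
  \<comment> \<open>The two bounds on the rate that \<open>exists_direction\<close> asks for.\<close>
  define \<kappa> where "\<kappa> = min (1 / M) (1 / s - 1 / t)"
  have \<kappa>: "0 < \<kappa>" "\<kappa> * M \<le> 1" "\<kappa> \<le> 1 / s - 1 / t"
    using \<open>0 < s\<close> \<open>0 < M\<close> st by (auto simp: \<kappa>_def field_simps min_def)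
  \<comment> \<open>The denominator compensates for the growth of the dense sequence, so that the weighted forms are
    dominated by one geometric series for all residuals.\<close>
  define weight where "weight k = (1 / 2) ^ k / (1 + (norm (e k))\<^sup>2)" for k :: nat
  have weight_pos: "0 < weight k" for k by (simp add: weight_def add_pos_nonneg)
  have weighted_le: "weight k * q \<le> M * (1 / 2) ^ k" if "q \<le> M * (norm (e k))\<^sup>2" for k q
  proof -
    have "q \<le> M * (1 + (norm (e k))\<^sup>2)" using that \<open>0 < M\<close> by (simp add: algebra_simps)
    then have "weight k * q \<le> weight k * (M * (1 + (norm (e k))\<^sup>2))"
      using weight_pos[of k] by (intro mult_left_mono) auto
    also have "\<dots> = M * (1 / 2) ^ k"
      using add_pos_nonneg[of 1 "(norm (e k))\<^sup>2"] by (simp add: weight_def)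
    finally show ?thesis .
  qed
  \<comment> \<open>The invariant of the residuals \<open>D n = B - (\<Sum>i<n. c i *\<^sub>R P i)\<close>.\<close>
  define admissible where "admissible D \<longleftrightarrow>
    positive_operator D \<and> t < ess_norm D \<and> (\<forall>z. qform D z \<le> M * (norm z)\<^sup>2)" for D
  define step where "step n D D' \<longleftrightarrow> (\<exists>x. norm x = 1 \<and> D' = D - c n *\<^sub>R outer x x \<and>
    (\<forall>z. qform D' z = qform D z - c n * (norm (ip z x))\<^sup>2) \<and>
    (\<exists>k. (\<forall>j. weight j * qform D (e j) \<le> 2 * (weight k * qform D (e k))) \<and>
      \<kappa> * qform D (e k) \<le> (norm (ip (e k) x))\<^sup>2))" for n D D'
  have next_step: "\<exists>D'. admissible D' \<and> step n D D'" if "admissible D" for n D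
  proof -
    have D: "positive_operator D" "t < ess_norm D" "\<And>z. qform D z \<le> M * (norm z)\<^sup>2"
      using that by (auto simp: admissible_def)
    have "\<exists>k. \<forall>j. weight j * qform D (e j) \<le> 2 * (weight k * qform D (e k))"
    proof (rule exists_nearly_maximal)
      show "0 \<le> weight k * qform D (e k)" for k using weight_pos[of k] by simp
      have "weight k * qform D (e k) \<le> M" for k
      proof -
        have "M * (1 / 2) ^ k \<le> M * 1"
          using \<open>0 < M\<close> by (intro mult_left_mono power_le_one) auto
        then show ?thesis using weighted_le[OF D(3), of k] by simp
      qed
      then show "bdd_above (range (\<lambda>k. weight k * qform D (e k)))" by (intro bdd_aboveI) auto
    qed
    then obtain k where k: "\<And>j. weight j * qform D (e j) \<le> 2 * (weight k * qform D (e k))"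
      by blast
    obtain u where u: "D u \<noteq> 0" "c n * qform D u \<le> (norm (D u))\<^sup>2"
      "\<kappa> * qform D (e k) * (norm (D u))\<^sup>2 \<le> (norm (ip (D u) (e k)))\<^sup>2"
      using exists_direction[OF D(1,3) c(1) cs st(1) D(2) \<kappa>] by blast
    define x where "x = (1 / norm (D u)) *\<^sub>R D u"
    define D' where "D' = D - c n *\<^sub>R outer x x"
    have "norm x = 1" using u(1) by (simp add: x_def)
    have "c n * (norm (ip z x))\<^sup>2 \<le> qform D z" for z
      unfolding x_def by (intro remove_rank_one D u less_imp_le c)
    note R = qform_minus_outer[OF D(1) this, folded D'_def]
    \<comment> \<open>The residual changes by a compact operator, so its essential norm stays above \<open>t\<close>.\<close>
    have "outer (c n *\<^sub>R x) x = D - D'"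
      by (rule blinfun_eqI)
        (simp add: D'_def blinfun.diff_left blinfun.scaleR_left outer.rep_eq scaleR_scale
          scale_of_real[symmetric] mult.commute scaleR_conv_of_real)
    then have "compact_operator (D - D')" by (metis compact_operator_outer)
    then have "t < ess_norm D'" using ess_norm_le_compact_perturbation D(2) by fastforce
    moreover have "qform D' z \<le> M * (norm z)\<^sup>2" for z
      using R(2)[of z] D(3)[of z] c(1)[of n] by (simp add: order_trans[rotated])
    ultimately have "admissible D'" using R(1) by (simp add: admissible_def)
    have "norm (ip (D u) (e k)) = norm (ip (e k) x) * norm (D u)"
      using norm_conjugate[of "ip (D u) (e k)"] u(1)
      by (simp add: x_def ip_simps norm_divide norm_mult ip_conjugate[of "e k" "D u"])
    then have "\<kappa> * qform D (e k) * (norm (D u))\<^sup>2 \<le> (norm (ip (e k) x))\<^sup>2 * (norm (D u))\<^sup>2"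
      using u(3) by (simp add: power_mult_distrib)
    then have "\<kappa> * qform D (e k) \<le> (norm (ip (e k) x))\<^sup>2"
      by (rule mult_right_le_imp_le) (use u(1) in simp)
    then have "step n D D'"
      unfolding step_def using \<open>norm x = 1\<close> R(2) k by (intro exI[of _ x]) (auto simp: D'_def)
    then show ?thesis using \<open>admissible D'\<close> by blast
  qed
  have "admissible B"
    unfolding admissible_def
  proof (intro conjI B st allI)
    fix z
    show "qform B z \<le> M * (norm z)\<^sup>2"
      using qform_le_norm[of B z] by (simp add: M_def distrib_right add_increasing2)
  qed
  then obtain D where D: "D 0 = B" "\<And>n. admissible (D n)" "\<And>n. step n (D n) (D (Suc n))"
    using dependent_nat_choice[of "\<lambda>n D. admissible D \<and> (n = 0 \<longrightarrow> D = B)" step] next_step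
    by (metis nat.distinct(2))
  obtain x where x: "\<And>n. norm (x n) = 1" "\<And>n. D (Suc n) = D n - c n *\<^sub>R outer (x n) (x n)"
    "\<And>n z. qform (D (Suc n)) z = qform (D n) z - c n * (norm (ip z (x n)))\<^sup>2"
    "\<And>n. \<exists>k. (\<forall>j. weight j * qform (D n) (e j) \<le> 2 * (weight k * qform (D n) (e k))) \<and>
      \<kappa> * qform (D n) (e k) \<le> (norm (ip (e k) (x n)))\<^sup>2"
    using D(3) unfolding step_def by metis
  have pos: "positive_operator (D n)" and qM: "qform (D n) z \<le> M * (norm z)\<^sup>2" for n z
    using D(2) by (auto simp: admissible_def)
  have weighted_lim: "(\<lambda>n. weight j * qform (D n) (e j)) \<longlonglongrightarrow> 0" for j
  proof (rule greedy_decay[where g = "\<lambda>k. M * (1 / 2) ^ k" and c = c and \<kappa> = \<kappa>])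
    show "0 \<le> weight k * qform (D n) (e k)" for n k using weight_pos[of k] by simp
    show "weight k * qform (D n) (e k) \<le> M * (1 / 2) ^ k" for n k by (intro weighted_le qM)
    show "summable (\<lambda>k. M * (1 / 2) ^ k)" by (intro summable_mult summable_geometric) simp
    show "weight k * qform (D (Suc n)) (e k) \<le> weight k * qform (D n) (e k)" for n k
      using weight_pos[of k] c(1)[of n] by (simp add: x(3))
    show "\<exists>k. (\<forall>j. weight j * qform (D n) (e j) \<le> 2 * (weight k * qform (D n) (e k))) \<and>
        weight k * qform (D (Suc n)) (e k) \<le> (1 - \<kappa> * c n) * (weight k * qform (D n) (e k))"
      for n
    proof -
      obtain k where k: "\<forall>j. weight j * qform (D n) (e j) \<le> 2 * (weight k * qform (D n) (e k))"
        "\<kappa> * qform (D n) (e k) \<le> (norm (ip (e k) (x n)))\<^sup>2" using x(4) by blast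
      have "(weight k * c n) * (\<kappa> * qform (D n) (e k))
          \<le> (weight k * c n) * (norm (ip (e k) (x n)))\<^sup>2"
        using weight_pos[of k] c(1)[of n] by (intro mult_left_mono k) auto
      then show ?thesis using k(1) by (intro exI[of _ k]) (simp add: x(3) algebra_simps)
    qed
  qed (use \<kappa> c diverges in \<open>auto intro: less_imp_le\<close>)
  have qform_lim: "(\<lambda>n. qform (D n) (e j)) \<longlonglongrightarrow> 0" for j
  proof -
    have "(1 / weight j) * (weight j * r) = r" for r using weight_pos[of j] by simp
    then show ?thesis
      using tendsto_mult_right_zero[OF weighted_lim[of j], of "1 / weight j"] by (simp only:)
  qed
  have lim: "(\<lambda>n. D n z) \<longlonglongrightarrow> 0" for z
    by (rule tendsto_zero_of_qform_dense[where D = D and M = M and e = e])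
      (fact pos qM \<open>0 < M\<close> dense qform_lim)+
  have partial: "(\<Sum>i<n. c i *\<^sub>R outer (x i) (x i)) = B - D n" for n
    by (induction n) (simp_all add: D(1) x(2))
  have "limitin strong_operator_topology (\<lambda>n. \<Sum>i<n. c i *\<^sub>R outer (x i) (x i)) B sequentially"
    unfolding limitin_strong_operator_topology_iff partial blinfun.diff_left
    using tendsto_diff[OF tendsto_const lim] by simp
  then show ?thesis
    using x(1) by (intro exI[of _ "\<lambda>i. outer (x i) (x i)"]) (simp add: rank_one_projection_outer)
qed

end

theorem theorem6:
  fixes scale :: "'k::real_or_complex \<Rightarrow> 'a::banach \<Rightarrow> 'a"
    and ip :: "'a \<Rightarrow> 'a \<Rightarrow> 'k"
    and B :: "'a \<Rightarrow>\<^sub>L 'a"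
    and c :: "nat \<Rightarrow> real"
  assumes "hilbert_space scale ip"
    and "separable_space (euclidean :: 'a topology)"
    and "hilbert_space.infinite_dimensional scale"
    and "hilbert_space.positive_operator scale ip B"
    and "\<not> hilbert_space.compact_operator scale B"
    and "\<And>i. c i > 0"
    and "bdd_above (range c)"
    and "(SUP i. c i) < hilbert_space.ess_norm scale B"
    and "filterlim (\<lambda>n. \<Sum>i<n. c i) at_top sequentially"
  shows "\<exists>P :: nat \<Rightarrow> 'a \<Rightarrow>\<^sub>L 'a.
    (\<forall>i. hilbert_space.rank_one_projection scale ip (P i)) \<and>
    limitin strong_operator_topology (\<lambda>n. \<Sum>i<n. c i *\<^sub>R P i) B sequentially"
  using hilbert_space.exists_rank_one_decomposition[OF assms(1,2,4,6,7,8,9)] .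

end
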